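(* For all integers $d\ge 1$, $n\ge 1$ and $0\le h\le n$, $$L_{n,h}^{(d+1)}=\sum_{j=0}^{\lfloor (n-h)/2\rfloor}\binom{n}{n-h-2j}\binom{h+2j}{j}\,l_{n-h-2j}^{(d)}=\sum_{\substack{0\le i\le n-h\\ i\equiv n-h \ (\mathrm{mod}\ 2)}}\binom{n}{i}\binom{n-i}{\frac{n-h-i}{2}}\,l_i^{(d)},$$ as an identity of functions on $\mathbb Z^d$.
   Context: A (simple) walk of length $n$ in $\mathbb R^d$ is a sequence of $n$ steps starting at the origin, each step being one of the $2d$ vectors $\pm e_1,\dots,\pm e_d$. The distribution $l_n^{(d)}:\mathbb Z^d\to\mathbb Z_{\ge 0}$ assigns to each lattice point $P$ the number of walks of length $n$ in $\mathbb R^d$ from the origin that end at $P$ (so $l_0^{(d)}$ is $1$ at the origin and $0$ elsewhere). The layer $L_{n,h}^{(d+1)}:\mathbb Z^d\to\mathbb Z_{\ge 0}$ is the part of the distribution of walks of length $n$ in $\mathbb R^{d+1}$ lying in the hyperplane $x_{d+1}=h$: $L_{n,h}^{(d+1)}(P)=l_n^{(d+1)}(P,h)$. Sums and integer multiples of distributions are taken pointwise, with all distributions centred at the origin of $\mathbb Z^d$. *)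

theory Defs
  imports Complex_Main "HOL-Number_Theory.Cong"
begin

text \<open>
  The dimension varies inside the statement (\<open>d\<close> and \<open>d + 1\<close>), so a point of \<open>\<int>\<^sup>d\<close> is an
  integer sequence vanishing outside the coordinates \<open>1, \<dots>, d\<close>.
\<close>

definition lattice :: "nat \<Rightarrow> (nat \<Rightarrow> int) set" where
  "lattice d = {P. \<forall>j. j \<notin> {1..d} \<longrightarrow> P j = 0}"

definition unit_vec :: "nat \<Rightarrow> nat \<Rightarrow> int" where
  "unit_vec i = (\<lambda>j. if j = i then 1 else 0)"

definition steps :: "nat \<Rightarrow> (nat \<Rightarrow> int) set" where
  "steps d = {unit_vec i | i. i \<in> {1..d}} \<union> {(\<lambda>j. - unit_vec i j) | i. i \<in> {1..d}}"

definition walks :: "nat \<Rightarrow> nat \<Rightarrow> (nat \<Rightarrow> int) list set" where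
  "walks d n = {w. length w = n \<and> set w \<subseteq> steps d}"

definition endpoint :: "(nat \<Rightarrow> int) list \<Rightarrow> nat \<Rightarrow> int" where
  "endpoint w = (\<lambda>j. \<Sum>s\<leftarrow>w. s j)"

definition walk_distr :: "nat \<Rightarrow> nat \<Rightarrow> (nat \<Rightarrow> int) \<Rightarrow> nat" where
  "walk_distr d n P = card {w \<in> walks d n. endpoint w = P}"

text \<open>
  \<open>layer m n h\<close> is the part of the \<open>m\<close>-dimensional distribution in the hyperplane
  \<open>x\<^sub>m = h\<close>, a function on \<open>lattice (m - 1)\<close>: for \<open>P\<close> in that lattice, \<open>P(m := h)\<close> is the
  point \<open>(P, h)\<close>.
\<close>

definition layer :: "nat \<Rightarrow> nat \<Rightarrow> int \<Rightarrow> (nat \<Rightarrow> int) \<Rightarrow> nat" where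
  "layer m n h P = walk_distr m n (P(m := h))"

end

theory Submission
  imports Defs
begin

text \<open>
  A walk in dimension \<open>d + 1\<close> that makes exactly \<open>i\<close> of its \<open>n\<close> steps inside the first \<open>d\<close>
  coordinates is an interleaving of a \<open>d\<close>-dimensional walk of length \<open>i\<close> with a walk of length
  \<open>n - i\<close> on the line, and there are \<open>n choose i\<close> ways to interleave.  Hence
  \<open>l\<^sub>n\<^sup>(\<^sup>d\<^sup>+\<^sup>1\<^sup>)(P, k)\<close> is the sum over \<open>i\<close> of \<open>n choose i\<close> times \<open>l\<^sub>i\<^sup>(\<^sup>d\<^sup>)(P)\<close> times the number of line
  walks of length \<open>n - i\<close> ending at \<open>k\<close> (\<open>walk_distr_Suc_dim\<close>).  A line walk of length \<open>m\<close> ends at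
  \<open>m - 2j\<close> when it has \<open>j\<close> steps down, so there are \<open>m choose j\<close> of them, and none end at a point
  of the wrong parity or out of reach.  Only the \<open>i = n - h - 2j\<close> contribute at height \<open>h\<close>, and
  listing them by \<open>j\<close> or by \<open>i\<close> gives the two sums.

  The interleaving formula is proved by induction on \<open>n\<close> rather than by a bijection: both sides
  satisfy the same recurrence in the first step, which on the right is Pascal's rule
  (\<open>sum_choose_Suc\<close>).
\<close>

section \<open>The first-step recurrence\<close>

lemma finite_steps: "finite (steps d)"
  unfolding steps_def by (simp add: setcompr_eq_image)

lemma steps_eq_0_outside: "s \<in> steps d \<Longrightarrow> d < j \<Longrightarrow> s j = 0"
  unfolding steps_def unit_vec_def by auto

lemma steps_Suc:
  "steps (Suc d) = insert (unit_vec (Suc d)) (insert (\<lambda>j. - unit_vec (Suc d) j) (steps d))"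
  unfolding steps_def by (auto simp: le_Suc_eq)

lemma sum_steps_Suc:
  fixes f :: "(nat \<Rightarrow> int) \<Rightarrow> 'a::comm_monoid_add"
  shows "sum f (steps (Suc d)) =
    f (unit_vec (Suc d)) + (f (\<lambda>j. - unit_vec (Suc d) j) + sum f (steps d))"
proof -
  let ?e = "unit_vec (Suc d)" and ?e' = "\<lambda>j. - unit_vec (Suc d) j"
  have "?e (Suc d) = 1"
    by (simp add: unit_vec_def)
  then have "?e \<notin> steps d" "?e' \<notin> steps d"
    using steps_eq_0_outside[of _ d "Suc d"] by fastforce+
  moreover have "?e \<noteq> ?e'"
    using \<open>?e (Suc d) = 1\<close> by (metis one_neq_neg_one)
  ultimately have "?e \<notin> insert ?e' (steps d)" "?e' \<notin> steps d"
    by simp_all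
  then show ?thesis
    unfolding steps_Suc by (simp add: finite_steps)
qed

lemma finite_walks: "finite (walks d n)"
  unfolding walks_def
  using finite_lists_length_eq[OF finite_steps[of d], of n] by (simp add: conj_commute)

lemma walk_distr_0: "walk_distr d 0 P = of_bool (P = (\<lambda>_. 0))"
proof -
  have "{w \<in> walks d 0. endpoint w = P} = (if P = (\<lambda>_. 0) then {[]} else {})"
    by (auto simp: walks_def endpoint_def)
  then show ?thesis
    by (simp add: walk_distr_def)
qed

lemma endpoint_Cons_eq_iff: "endpoint (s # w) = P \<longleftrightarrow> endpoint w = (\<lambda>j. P j - s j)"
  by (auto simp: endpoint_def fun_eq_iff algebra_simps)

lemma walk_distr_Suc:
  "walk_distr d (Suc n) P = (\<Sum>s\<in>steps d. walk_distr d n (\<lambda>j. P j - s j))"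
proof -
  let ?W = "\<lambda>s. {w \<in> walks d n. endpoint w = (\<lambda>j. P j - s j)}"
  have "{w \<in> walks d (Suc n). endpoint w = P} = (\<Union>s\<in>steps d. (#) s ` ?W s)"
  proof (intro set_eqI iffI)
    fix w assume "w \<in> {w \<in> walks d (Suc n). endpoint w = P}"
    then obtain s v where "w = s # v" "s \<in> steps d" "v \<in> ?W s"
      by (cases w) (auto simp: walks_def endpoint_Cons_eq_iff)
    then show "w \<in> (\<Union>s\<in>steps d. (#) s ` ?W s)"
      by blast
  qed (auto simp: walks_def endpoint_Cons_eq_iff)
  then have "walk_distr d (Suc n) P = card (\<Union>s\<in>steps d. (#) s ` ?W s)"
    by (simp add: walk_distr_def)
  also have "\<dots> = (\<Sum>s\<in>steps d. card ((#) s ` ?W s))"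
    by (rule card_UN_disjoint) (auto simp: finite_steps finite_walks)
  also have "\<dots> = (\<Sum>s\<in>steps d. walk_distr d n (\<lambda>j. P j - s j))"
    by (simp add: walk_distr_def card_image)
  finally show ?thesis .
qed

section \<open>Walks on the line\<close>

text \<open>
  The number of \<open>\<plusminus>1\<close> walks of length \<open>m\<close> from \<open>0\<close> to \<open>k\<close>.  The recurrence in the first step is
  taken as the definition because the induction in \<open>walk_distr_Suc_dim\<close> consumes exactly that.
\<close>

fun line_walks :: "nat \<Rightarrow> int \<Rightarrow> nat" where
  "line_walks 0 k = of_bool (k = 0)"
| "line_walks (Suc m) k = line_walks m (k - 1) + line_walks m (k + 1)"

lemma line_walks_out_of_reach: "int m < k \<Longrightarrow> line_walks m k = 0"
  by (induction m arbitrary: k) auto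

lemma line_walks_wrong_parity: "odd (int m - k) \<Longrightarrow> line_walks m k = 0"
proof (induction m arbitrary: k)
  case (Suc m)
  then have "odd (int m - (k - 1))" "odd (int m - (k + 1))"
    by presburger+
  then show ?case
    using Suc.IH by simp
qed auto

text \<open>
  The number \<open>j\<close> counts the steps down.  It may exceed \<open>m\<close>, where both sides vanish, so that the
  induction step, which is Pascal's rule, needs no separate case for \<open>j = m + 1\<close>.
\<close>

lemma line_walks_eq_choose: "line_walks m (int m - 2 * int j) = m choose j"
proof (induction m arbitrary: j)
  case 0
  then show ?case by (cases j) auto
next
  case (Suc m)
  show ?case
  proof (cases j)
    case 0
    then show ?thesis
      using Suc.IH[of 0] by (simp add: line_walks_out_of_reach)
  next
    case (Suc i)
    have down: "int (Suc m) - 2 * int j - 1 = int m - 2 * int (Suc i)"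
      and up: "int (Suc m) - 2 * int j + 1 = int m - 2 * int i"
      using Suc by simp_all
    show ?thesis
      unfolding line_walks.simps down up Suc.IH using Suc by simp
  qed
qed

section \<open>Interleaving with walks on the line\<close>

text \<open>
  Pascal's rule for a binomial convolution.  If \<open>f a b\<close> counts pairs of words of lengths \<open>a\<close> and
  \<open>b\<close>, both sides count the ways to interleave such a pair into a word of length \<open>n + 1\<close>; the right
  side distinguishes whether the first letter belongs to the first or to the second word.
\<close>

lemma sum_choose_Suc:
  fixes f :: "nat \<Rightarrow> nat \<Rightarrow> nat"
  shows "(\<Sum>i\<le>Suc n. (Suc n choose i) * f i (Suc n - i)) =
    (\<Sum>i\<le>n. (n choose i) * (f (Suc i) (n - i) + f i (Suc (n - i))))"
proof -
  have "(\<Sum>i\<le>Suc n. (Suc n choose i) * f i (Suc n - i)) =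
      f 0 (Suc n) + (\<Sum>i\<le>n. (n choose Suc i) * f (Suc i) (n - i)) +
      (\<Sum>i\<le>n. (n choose i) * f (Suc i) (n - i))"
    by (simp add: sum.atMost_Suc_shift algebra_simps sum.distrib del: sum.atMost_Suc)
  also have "f 0 (Suc n) + (\<Sum>i\<le>n. (n choose Suc i) * f (Suc i) (n - i)) =
      (\<Sum>i\<le>Suc n. (n choose i) * f i (Suc n - i))"
    by (simp add: sum.atMost_Suc_shift del: sum.atMost_Suc)
  also have "\<dots> = (\<Sum>i\<le>n. (n choose i) * f i (Suc (n - i)))"
    by (simp add: Suc_diff_le)
  finally show ?thesis
    by (simp add: algebra_simps sum.distrib)
qed

text \<open>
  A walk in dimension \<open>d + 1\<close> is an interleaving of its \<open>i\<close> steps along the first \<open>d\<close> axes with its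
  \<open>n - i\<close> steps along the last one.  The assumption makes \<open>P\<close> a possible endpoint of the former
  steps, none of which moves coordinate \<open>d + 1\<close>.
\<close>

lemma walk_distr_Suc_dim:
  assumes "P (Suc d) = 0"
  shows "walk_distr (Suc d) n (P(Suc d := k)) =
    (\<Sum>i\<le>n. (n choose i) * (walk_distr d i P * line_walks (n - i) k))"
  using assms
proof (induction n arbitrary: P k)
  case 0
  have "P(Suc d := k) = (\<lambda>_. 0) \<longleftrightarrow> P = (\<lambda>_. 0) \<and> k = 0"
    using 0 by (auto simp: fun_eq_iff)
  then have "walk_distr (Suc d) 0 (P(Suc d := k)) = of_bool (P = (\<lambda>_. 0) \<and> k = 0)"
    by (simp only: walk_distr_0)
  then show ?case
    by (simp add: walk_distr_0 of_bool_conj del: fun_upd_apply)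
next
  case (Suc n)
  let ?l = "walk_distr d" and ?V = line_walks and ?e = "unit_vec (Suc d)"
  let ?P = "P(Suc d := k)"
  have up: "(\<lambda>j. ?P j - ?e j) = P(Suc d := k - 1)"
    and down: "(\<lambda>j. ?P j - - ?e j) = P(Suc d := k + 1)"
    by (auto simp: unit_vec_def fun_eq_iff)
  have side: "walk_distr (Suc d) n (\<lambda>j. ?P j - s j) =
      (\<Sum>i\<le>n. (n choose i) * (?l i (\<lambda>j. P j - s j) * ?V (n - i) k))" if "s \<in> steps d" for s
  proof -
    have "s (Suc d) = 0"
      using that by (simp add: steps_eq_0_outside)
    then have shift: "(\<lambda>j. ?P j - s j) = (\<lambda>j. P j - s j)(Suc d := k)"
      by (auto simp: fun_eq_iff)
    show ?thesis
      unfolding shift by (rule Suc.IH) (simp add: Suc.prems \<open>s (Suc d) = 0\<close>)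
  qed
  \<comment> \<open>A first step inside the first \<open>d\<close> coordinates lengthens the \<open>d\<close>-dimensional part of the walk,
    which the recurrence for \<open>walk_distr d\<close>, read backwards, turns into \<open>walk_distr d (Suc i)\<close>.\<close>
  have "(\<Sum>s\<in>steps d. walk_distr (Suc d) n (\<lambda>j. ?P j - s j)) =
      (\<Sum>s\<in>steps d. \<Sum>i\<le>n. (n choose i) * (?l i (\<lambda>j. P j - s j) * ?V (n - i) k))"
    by (rule sum.cong[OF refl side])
  also have "\<dots> = (\<Sum>i\<le>n. (n choose i) * (?l (Suc i) P * ?V (n - i) k))"
    by (subst sum.swap) (simp add: walk_distr_Suc sum_distrib_left sum_distrib_right)
  finally have "walk_distr (Suc d) (Suc n) ?P =
      (\<Sum>i\<le>n. (n choose i) * (?l i P * ?V (n - i) (k - 1))) +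
      ((\<Sum>i\<le>n. (n choose i) * (?l i P * ?V (n - i) (k + 1))) +
       (\<Sum>i\<le>n. (n choose i) * (?l (Suc i) P * ?V (n - i) k)))"
    unfolding walk_distr_Suc[of "Suc d"] sum_steps_Suc up down
    by (simp only: Suc.IH[of P, OF Suc.prems])
  also have "\<dots> = (\<Sum>i\<le>n. (n choose i) *
      (?l (Suc i) P * ?V (n - i) k + ?l i P * ?V (Suc (n - i)) k))"
    by (simp add: algebra_simps sum.distrib)
  also have "\<dots> = (\<Sum>i\<le>Suc n. (Suc n choose i) * (?l i P * ?V (Suc n - i) k))"
    by (rule sum_choose_Suc[symmetric])
  finally show ?case .
qed

section \<open>The layers\<close>

lemma cong_2_iff_even: "[a = b] (mod 2) \<longleftrightarrow> (even a \<longleftrightarrow> even b)" for a b :: nat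
  by (auto simp: cong_def mod_2_eq_odd)

lemma double_half_diff:
  fixes i m :: nat
  assumes "i \<le> m" and "[i = m] (mod 2)"
  shows "2 * ((m - i) div 2) = m - i"
  using assms by (auto simp: cong_2_iff_even)

text \<open>
  The index set consists of the \<open>i\<close> for which a line walk of length \<open>n - i\<close> can
  reach height \<open>h\<close>; the remaining terms of \<open>walk_distr_Suc_dim\<close> vanish.
\<close>

lemma layer_eq_sum_choose:
  assumes "P (Suc d) = 0" and "h \<le> n"
  shows "layer (Suc d) n (int h) P = (\<Sum>i | i \<le> n - h \<and> [i = n - h] (mod 2).
    (n choose i) * ((n - i) choose ((n - h - i) div 2)) * walk_distr d i P)"
proof -
  let ?I = "{i. i \<le> n - h \<and> [i = n - h] (mod 2)}"
  let ?t = "\<lambda>i. (n choose i) * (walk_distr d i P * line_walks (n - i) (int h))"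
  have "layer (Suc d) n (int h) P = sum ?t {..n}"
    using assms(1) by (simp add: layer_def walk_distr_Suc_dim)
  also have "\<dots> = sum ?t ?I"
  proof (rule sum.mono_neutral_right)
    show "\<forall>i\<in>{..n} - ?I. ?t i = 0"
    proof
      fix i assume "i \<in> {..n} - ?I"
      then have "i \<le> n" and "n - h < i \<or> \<not> [i = n - h] (mod 2)"
        by auto
      then have "int (n - i) < int h \<or> odd (int (n - i) - int h)"
        using assms(2) by (auto simp: cong_2_iff_even)
      then have "line_walks (n - i) (int h) = 0"
        using line_walks_out_of_reach line_walks_wrong_parity by blast
      then show "?t i = 0"
        by simp
    qed
  qed auto
  also have "\<dots> = (\<Sum>i\<in>?I.
      (n choose i) * ((n - i) choose ((n - h - i) div 2)) * walk_distr d i P)"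
  proof (rule sum.cong)
    fix i assume "i \<in> ?I"
    then have "i \<le> n - h" and "2 * ((n - h - i) div 2) = n - h - i"
      using double_half_diff[of i "n - h"] by blast+
    then have "int h = int (n - i) - 2 * int ((n - h - i) div 2)"
      using assms(2) by linarith
    then have "line_walks (n - i) (int h) = (n - i) choose ((n - h - i) div 2)"
      using line_walks_eq_choose[of "n - i" "(n - h - i) div 2"] by simp
    then show "?t i = (n choose i) * ((n - i) choose ((n - h - i) div 2)) * walk_distr d i P"
      by simp
  qed simp
  finally show ?thesis .
qed

lemma sum_same_parity_reindex:
  fixes f :: "nat \<Rightarrow> 'a::comm_monoid_add"
  shows "(\<Sum>i | i \<le> m \<and> [i = m] (mod 2). f i) = (\<Sum>j = 0..m div 2. f (m - 2 * j))"
proof (rule sum.reindex_bij_witness[where i = "\<lambda>j. m - 2 * j" and j = "\<lambda>i. (m - i) div 2"])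
  fix i assume "i \<in> {i. i \<le> m \<and> [i = m] (mod 2)}"
  then show "m - 2 * ((m - i) div 2) = i"
    by (simp add: double_half_diff)
  then show "f (m - 2 * ((m - i) div 2)) = f i"
    by simp
  show "(m - i) div 2 \<in> {0..m div 2}"
    by (simp add: div_le_mono)
next
  fix j assume "j \<in> {0..m div 2}"
  then have "2 * j \<le> m"
    by auto
  then show "(m - (m - 2 * j)) div 2 = j"
    by simp
  show "m - 2 * j \<in> {i. i \<le> m \<and> [i = m] (mod 2)}"
    using \<open>2 * j \<le> m\<close> by (auto simp: cong_2_iff_even)
qed

theorem theorem1:
  fixes d n h :: nat
  assumes "d \<ge> 1" and "n \<ge> 1" and "h \<le> n"
  shows "\<forall>P \<in> lattice d.
    layer (d + 1) n (int h) P =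
      (\<Sum>j = 0..(n - h) div 2.
        (n choose (n - h - 2 * j)) * ((h + 2 * j) choose j) * walk_distr d (n - h - 2 * j) P) \<and>
    (\<Sum>j = 0..(n - h) div 2.
        (n choose (n - h - 2 * j)) * ((h + 2 * j) choose j) * walk_distr d (n - h - 2 * j) P) =
      (\<Sum>i | i \<le> n - h \<and> [i = n - h] (mod 2).
        (n choose i) * ((n - i) choose ((n - h - i) div 2)) * walk_distr d i P)"
proof
  fix P assume "P \<in> lattice d"
  let ?f = "\<lambda>i. (n choose i) * ((n - i) choose ((n - h - i) div 2)) * walk_distr d i P"
  let ?g = "\<lambda>j. (n choose (n - h - 2 * j)) * ((h + 2 * j) choose j) * walk_distr d (n - h - 2 * j) P"
  have "P (Suc d) = 0"
    using \<open>P \<in> lattice d\<close> by (simp add: lattice_def)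
  then have "layer (d + 1) n (int h) P = (\<Sum>i | i \<le> n - h \<and> [i = n - h] (mod 2). ?f i)"
    using layer_eq_sum_choose assms(3) by simp
  moreover have "(\<Sum>j = 0..(n - h) div 2. ?g j) =
      (\<Sum>i | i \<le> n - h \<and> [i = n - h] (mod 2). ?f i)"
    unfolding sum_same_parity_reindex
  proof (rule sum.cong)
    fix j assume "j \<in> {0..(n - h) div 2}"
    then have "2 * j \<le> n - h"
      by auto
    then have "n - (n - h - 2 * j) = h + 2 * j" "(n - h - (n - h - 2 * j)) div 2 = j"
      using assms(3) by simp_all
    then show "?g j = ?f (n - h - 2 * j)"
      by simp
  qed simp
  ultimately show "layer (d + 1) n (int h) P = (\<Sum>j = 0..(n - h) div 2. ?g j) \<and>
      (\<Sum>j = 0..(n - h) div 2. ?g j) = (\<Sum>i | i \<le> n - h \<and> [i = n - h] (mod 2). ?f i)"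
    by simp
qed

end
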